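(* Let $(X_k)_k$ be a sequence of i.i.d. symmetric real random variables with the same law as $X$, where $\mathbb{E}(X)=0$, $\mathbb{E}(X^2)=1$ and $\mathbb{E}(X^4)<3$. Set $$Z_n:=\frac1{n^{1/4}}\sum_{k=1}^nX_k,\quad \gamma_n:=n^{1/4},\quad C:=\frac{3-\mathbb{E}(X^4)}6,\quad c_1:=\sqrt{2\pi}\,\mathbb{E}(e^{-CG^4/4}),\ G\sim\mathcal{N}(0,1),$$ and let $H_n\sim\mathscr{H}(\Phi_C,\gamma_n)$. Then $$d_{\mathrm{Kol}}(Z_n,H_n):=\sup_{x\in\mathbb{R}}\big|\mathbb{P}(Z_n\leq x)-\mathbb{P}(H_n\leq x)\big|\leq\frac{4(1-C)^{1/4}c_1^{-1/2}}{\gamma_n}+O\Big(\frac1{\gamma_n^2}\Big)$$ as $n\to\infty$.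
   Context: $X$ symmetric means that $X$ and $-X$ have the same law. With $\Phi_C(x):=e^{-Cx^4/4}$ and $\gamma>0$, $\mathscr{H}(\Phi_C,\gamma)$ is the probability distribution on $\mathbb{R}$ with density proportional to $\Phi_C(x/\gamma^2)e^{-x^2/(2\gamma^2)}=\exp\big(-\frac{x^2}{2\gamma^2}-\frac{C}{\gamma^8}\frac{x^4}4\big)$. *)

theory Defs
  imports "HOL-Probability.Probability"
begin

definition symmetric_rv :: "'a measure \<Rightarrow> ('a \<Rightarrow> real) \<Rightarrow> bool" where
  "symmetric_rv M X \<longleftrightarrow> distr M borel (\<lambda>\<omega>. - X \<omega>) = distr M borel X"

text \<open>The two variables may live on different probability spaces. The supremum is taken over a
  set bounded by 1, so the conditionally complete \<open>SUP\<close> of the reals is the genuine one.\<close>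

definition d_Kol :: "'a measure \<Rightarrow> ('a \<Rightarrow> real) \<Rightarrow> 'b measure \<Rightarrow> ('b \<Rightarrow> real) \<Rightarrow> real" where
  "d_Kol M Z N H =
     (SUP x. \<bar>measure M {\<omega> \<in> space M. Z \<omega> \<le> x} - measure N {\<omega> \<in> space N. H \<omega> \<le> x}\<bar>)"

definition Phi :: "real \<Rightarrow> real \<Rightarrow> real" where
  "Phi C x = exp (- C * x ^ 4 / 4)"

definition H_weight :: "(real \<Rightarrow> real) \<Rightarrow> real \<Rightarrow> real \<Rightarrow> real" where
  "H_weight \<Phi> \<gamma> x = \<Phi> (x / \<gamma>\<^sup>2) * exp (- (x\<^sup>2) / (2 * \<gamma>\<^sup>2))"

text \<open>A probability measure only when the weight is nonnegative and integrable with nonzero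
  integral, as for \<open>\<Phi> = Phi C\<close> with \<open>C \<ge> 0\<close> and \<open>\<gamma> > 0\<close>.\<close>

definition H_law :: "(real \<Rightarrow> real) \<Rightarrow> real \<Rightarrow> real measure" where
  "H_law \<Phi> \<gamma> =
     density lborel (\<lambda>x. ennreal (H_weight \<Phi> \<gamma> x / (\<integral>y. H_weight \<Phi> \<gamma> y \<partial>lborel)))"

end

theory Submission
  imports Defs "HOL-Real_Asymp.Real_Asymp"
begin

text \<open>Rescaled by \<open>\<gamma>\<^sub>n\<close>, the distance compares \<open>S\<^sub>n / sqrt n\<close> with a law that is within
  \<open>O(1/n)\<close> of the standard normal one. Since the allowed leading term is a positive constant times
  \<open>n powr (-1/4)\<close>, any normal approximation with an error \<open>o(n powr (-1/4))\<close> suffices, and the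
  remainder can then be taken to vanish for large \<open>n\<close>. Such an approximation follows by adding an
  independent \<open>N(0, \<epsilon>\<^sup>2)\<close> variable to both laws, comparing characteristic functions through Levy's
  inversion formula, and removing the noise by Chebyshev's inequality, with
  \<open>\<epsilon> = n powr (-2/5)\<close>.\<close>

section \<open>Levy inversion and Gaussian smoothing\<close>

text \<open>Levy's formula gives the mass of an interval as a limit of truncated integrals of its
  kernel times the characteristic function. The kernel is at most 2 / |t| whatever the endpoints,
  which cancels the factor |t| in the hypothesis; 2 \<open>g\<close> / (2 pi) then gives the
  constant. Absence of atoms makes the formula valid at every endpoint.\<close>

lemma cdf_diff_le_char_integral:
  fixes \<mu> \<nu> :: "real measure" and g :: "real \<Rightarrow> real"
  assumes "real_distribution \<mu>" "real_distribution \<nu>"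
    and atomless: "\<And>a. measure \<mu> {a} = 0" "\<And>a. measure \<nu> {a} = 0"
    and g: "integrable lborel g" "\<And>t. cmod (char \<mu> t - char \<nu> t) \<le> \<bar>t\<bar> * g t"
    and g_nonneg: "\<And>t. 0 \<le> g t"
  shows "\<bar>cdf \<mu> x - cdf \<nu> x\<bar> \<le> integral\<^sup>L lborel g / pi"
proof -
  interpret \<mu>: real_distribution \<mu> by fact
  interpret \<nu>: real_distribution \<nu> by fact
  have diff: "\<bar>measure \<mu> {a<..b} - measure \<nu> {a<..b}\<bar> \<le> integral\<^sup>L lborel g / pi"
    if ab: "a < b" for a b
  proof -
    define F where "F t = (iexp (-(t * a)) - iexp (-(t * b))) / (\<i> * complex_of_real t)" for t
    have F_meas [measurable]: "F \<in> borel_measurable borel"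
      unfolding F_def by measurable
    \<comment> \<open>This bound is finite near 0 and only serves integrability on bounded
      intervals; it is useless for the estimate because it grows with \<open>b - a\<close>.\<close>
    have F_le: "cmod (F t) \<le> b - a" if "t \<noteq> 0" for t
      using Levy_Inversion_aux2[of "-b" "-a" t] ab that by (simp add: F_def)
    have ae0: "AE t in lborel. t \<noteq> (0::real)"
      by (intro AE_I [of _ _ "{0}"]) auto
    \<comment> \<open>This bound is uniform in the endpoints. At \<open>t = 0\<close> both sides are
      0 by the convention for division by zero.\<close>
    have F_le2: "cmod (F t) \<le> 2 / \<bar>t\<bar>" for t
    proof -
      have "cmod (iexp (-(t * a)) - iexp (-(t * b))) \<le> cmod (iexp (-(t * a))) + cmod (iexp (-(t * b)))"
        by (rule norm_triangle_ineq4)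
      also have "\<dots> = 2" by (simp only: norm_exp_i_times)
      finally show ?thesis by (simp add: F_def norm_divide norm_mult divide_right_mono)
    qed
    have int: "complex_interval_lebesgue_integrable lborel (ereal u) (ereal v) (\<lambda>t. F t * char \<rho> t)"
      if "real_distribution \<rho>" for \<rho> u v
    proof -
      interpret \<rho>: real_distribution \<rho> by fact
      have "cmod (F t * char \<rho> t) \<le> (b - a) * 1" if "t \<noteq> 0" for t
        unfolding norm_mult using F_le[OF that] \<rho>.cmod_char_le_1 ab by (intro mult_mono) auto
      then show ?thesis
        apply (simp add: interval_lebesgue_integrable_def set_integrable_def)
        apply (intro integrableI_bounded_set_indicator[where B="b - a"] conjI impI)
        using ae0 by (auto elim!: eventually_mono)
    qed
    define D where "D T = 1 / (2 * pi) * (CLBINT t=-T..T. F t * char \<mu> t)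
          - 1 / (2 * pi) * (CLBINT t=-T..T. F t * char \<nu> t)" for T :: real
    have levy: "(\<lambda>n. 1 / (2 * pi) * (CLBINT t=-real n..real n. F t * char \<rho> t)) \<longlonglongrightarrow> measure \<rho> {a<..b}"
      if "real_distribution \<rho>" "\<And>a. measure \<rho> {a} = 0" for \<rho>
      using real_distribution.Levy_Inversion[OF that(1) less_imp_le[OF ab] that(2) that(2)]
      by (simp add: F_def)
    have lim: "(\<lambda>n. D (real n)) \<longlonglongrightarrow> complex_of_real (measure \<mu> {a<..b}) - complex_of_real (measure \<nu> {a<..b})"
      unfolding D_def by (intro tendsto_diff levy assms(1,2) atomless)
    have bound: "cmod (D (real n)) \<le> integral\<^sup>L lborel g / pi" for n
    proof -
      have "D (real n) = 1 / (2 * pi) * (CLBINT t=-real n..real n. F t * char \<mu> t - F t * char \<nu> t)"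
        unfolding D_def using int assms(1,2)
        by (subst interval_lebesgue_integral_diff(2)) (auto simp: right_diff_distrib)
      also have "(CLBINT t=-real n..real n. F t * char \<mu> t - F t * char \<nu> t)
          = (CLBINT t:{-real n<..<real n}. F t * (char \<mu> t - char \<nu> t))"
        by (simp add: interval_lebesgue_integral_def right_diff_distrib)
      also have "cmod (1 / (2 * pi) * \<dots>) = 1 / (2 * pi) * cmod \<dots>"
        by (simp add: norm_mult norm_divide)
      also have "cmod (CLBINT t:{-real n<..<real n}. F t * (char \<mu> t - char \<nu> t)) \<le> (\<integral>t. 2 * g t \<partial>lborel)"
        unfolding set_lebesgue_integral_def
      proof (rule Bochner_Integration.integral_norm_bound_integral)
        show "integrable lborel (\<lambda>t. indicator {-real n<..<real n} t *\<^sub>R (F t * (char \<mu> t - char \<nu> t)))"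
          using interval_lebesgue_integral_diff(1)[OF int[OF assms(1)] int[OF assms(2)], of "-real n" "real n"]
          by (simp add: interval_lebesgue_integrable_def set_integrable_def right_diff_distrib)
        show "integrable lborel (\<lambda>t. 2 * g t)" using g(1) by simp
        fix t :: real
        have "cmod (F t * (char \<mu> t - char \<nu> t)) \<le> 2 / \<bar>t\<bar> * (\<bar>t\<bar> * g t)"
          unfolding norm_mult using F_le2 g(2) by (intro mult_mono) auto
        also have "\<dots> \<le> 2 * g t" using g_nonneg[of t] by (cases "t = 0") auto
        finally show "cmod (indicator {-real n<..<real n} t *\<^sub>R (F t * (char \<mu> t - char \<nu> t))) \<le> 2 * g t"
          using g_nonneg[of t] by (auto split: split_indicator)
      qed
      finally show ?thesis by (simp add: divide_simps)
    qed
    have "cmod (complex_of_real (measure \<mu> {a<..b}) - complex_of_real (measure \<nu> {a<..b}))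
        \<le> integral\<^sup>L lborel g / pi"
      by (rule tendsto_upperbound[OF tendsto_norm[OF lim]]) (auto simp: bound)
    then show ?thesis by (metis norm_of_real of_real_diff)
  qed
  \<comment> \<open>Since the interval bound does not depend on \<open>a\<close>, letting
    \<open>a\<close> tend to minus infinity turns it into a bound on the distribution
    functions.\<close>
  have "((\<lambda>a. \<bar>(cdf \<mu> x - cdf \<mu> a) - (cdf \<nu> x - cdf \<nu> a)\<bar>) \<longlongrightarrow> \<bar>(cdf \<mu> x - 0) - (cdf \<nu> x - 0)\<bar>) at_bot"
    by (intro tendsto_intros \<mu>.cdf_lim_at_bot \<nu>.cdf_lim_at_bot)
  moreover have "\<forall>\<^sub>F a in at_bot. \<bar>(cdf \<mu> x - cdf \<mu> a) - (cdf \<nu> x - cdf \<nu> a)\<bar> \<le> integral\<^sup>L lborel g / pi"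
    using eventually_gt_at_bot[of x]
    by (rule eventually_mono) (simp only: \<mu>.cdf_diff_eq \<nu>.cdf_diff_eq diff)
  ultimately have "\<bar>(cdf \<mu> x - 0) - (cdf \<nu> x - 0)\<bar> \<le> integral\<^sup>L lborel g / pi"
    by (rule tendsto_upperbound) simp
  then show ?thesis by simp
qed

text \<open>This is the convolution of \<open>\<mu>\<close> with N(0, \<open>\<epsilon>\<close>^2).
  Encoding it as the image of a product keeps the point and the noise as coordinates of one space,
  so that events about both can be compared.\<close>

definition gauss_smooth :: "real \<Rightarrow> real measure \<Rightarrow> real measure" where
  "gauss_smooth \<epsilon> \<mu> = distr (\<mu> \<Otimes>\<^sub>M std_normal_distribution) borel (\<lambda>(x, z). x + \<epsilon> * z)"

context real_distribution
begin

interpretation SN: real_distribution std_normal_distribution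
  by (rule real_dist_normal_dist)

interpretation P: pair_prob_space M std_normal_distribution ..

lemma measurable_add_noise [measurable]:
  "(\<lambda>(x, z). x + \<epsilon> * z) \<in> borel_measurable (M \<Otimes>\<^sub>M std_normal_distribution)"
  by measurable

lemma real_distribution_gauss_smooth: "real_distribution (gauss_smooth \<epsilon> M)"
  unfolding gauss_smooth_def by (rule P.real_distribution_distr) measurable

text \<open>By Fubini and independence the noise contributes a Gaussian factor. It damps the high
  frequencies, where nothing better than a trivial bound on the characteristic functions is
  available.\<close>

lemma char_gauss_smooth: "char (gauss_smooth \<epsilon> M) t = char M t * exp (- (\<epsilon> * t)\<^sup>2 / 2)"
proof -
  have [measurable]: "(\<lambda>(x::real, z::real). iexp (t * (x + \<epsilon> * z))) \<in> borel_measurable (M \<Otimes>\<^sub>M std_normal_distribution)"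
    by measurable
  have "char (gauss_smooth \<epsilon> M) t = (CLINT p|M \<Otimes>\<^sub>M std_normal_distribution. iexp (t * (fst p + \<epsilon> * snd p)))"
    unfolding char_def gauss_smooth_def by (subst integral_distr) (auto simp: case_prod_beta)
  also have "\<dots> = (CLINT x|M. CLINT z|std_normal_distribution. iexp (t * (x + \<epsilon> * z)))"
    by (subst P.integral_fst'[symmetric]) (auto intro!: P.P.integrable_const_bound[where B=1] simp del: of_real_mult of_real_add)
  also have "\<dots> = (CLINT x|M. iexp (t * x) * char std_normal_distribution (\<epsilon> * t))"
    unfolding char_def
    by (subst integral_mult_right_zero[symmetric]) (simp add: algebra_simps exp_add)
  also have "\<dots> = char M t * char std_normal_distribution (\<epsilon> * t)"
    by (simp add: char_def)
  finally show ?thesis by (simp add: char_std_normal_distribution)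
qed

text \<open>For each fixed first coordinate a single noise value hits \<open>a\<close>, and the
  normal law does not charge it. Smoothing thus makes Levy inversion usable even for lattice
  laws.\<close>

lemma measure_gauss_smooth_singleton:
  assumes "\<epsilon> > 0"
  shows "measure (gauss_smooth \<epsilon> M) {a} = 0"
proof -
  have "emeasure (gauss_smooth \<epsilon> M) {a}
      = emeasure (M \<Otimes>\<^sub>M std_normal_distribution) ((\<lambda>(x, z). x + \<epsilon> * z) -` {a} \<inter> space (M \<Otimes>\<^sub>M std_normal_distribution))"
    unfolding gauss_smooth_def by (rule emeasure_distr) auto
  also have "\<dots> = (\<integral>\<^sup>+ x. emeasure std_normal_distribution
       (Pair x -` ((\<lambda>(x, z). x + \<epsilon> * z) -` {a} \<inter> space (M \<Otimes>\<^sub>M std_normal_distribution))) \<partial>M)"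
    by (rule SN.emeasure_pair_measure_alt) (rule measurable_sets[OF measurable_add_noise], simp)
  also have "\<dots> = (\<integral>\<^sup>+ x. 0 \<partial>M)"
  proof (rule nn_integral_cong)
    fix x
    have "Pair x -` ((\<lambda>(x, z). x + \<epsilon> * z) -` {a} \<inter> space (M \<Otimes>\<^sub>M std_normal_distribution)) = {(a - x) / \<epsilon>}"
      using assms by (auto simp: space_pair_measure field_simps)
    moreover have "emeasure std_normal_distribution {c} = 0" for c
    proof -
      have "emeasure std_normal_distribution {c} = (\<integral>\<^sup>+x. ennreal (std_normal_density x) * indicator {c} x \<partial>lborel)"
        by (rule emeasure_density) auto
      also have "\<dots> = 0"
        by (rule nn_integral_null_set) (simp add: null_sets_def)
      finally show ?thesis .
    qed
    ultimately show "emeasure std_normal_distribution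
       (Pair x -` ((\<lambda>(x, z). x + \<epsilon> * z) -` {a} \<inter> space (M \<Otimes>\<^sub>M std_normal_distribution))) = 0"
      by simp
  qed
  finally show ?thesis by (simp add: measure_def)
qed

lemma measure_pair_normal_Times:
  assumes "A \<in> sets borel" "B \<in> sets borel"
  shows "measure (M \<Otimes>\<^sub>M std_normal_distribution) (A \<times> B) = prob A * measure std_normal_distribution B"
  using SN.emeasure_pair_measure_Times[of A M B] assms by (simp add: measure_def enn2real_mult)

lemma measure_snd_tail:
  assumes "\<epsilon> > 0" "\<delta> > 0"
  shows "measure (M \<Otimes>\<^sub>M std_normal_distribution) {p. \<delta> \<le> \<bar>\<epsilon> * snd p\<bar>} \<le> (\<epsilon> / \<delta>)\<^sup>2"
proof -
  have "measure (M \<Otimes>\<^sub>M std_normal_distribution) {p. \<delta> \<le> \<bar>\<epsilon> * snd p\<bar>}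
      = measure (M \<Otimes>\<^sub>M std_normal_distribution) (space M \<times> {z. \<delta> / \<epsilon> \<le> \<bar>z\<bar>})"
    using assms by (intro arg_cong[where f="measure _"]) (auto simp: abs_mult field_simps)
  also have "\<dots> = measure std_normal_distribution {z. \<delta> / \<epsilon> \<le> \<bar>z\<bar>}"
    using prob_space by (subst measure_pair_normal_Times) auto
  also have "\<dots> \<le> (\<epsilon> / \<delta>)\<^sup>2"
    using SN.Chebyshev_inequality[of "\<lambda>z. z" "\<delta> / \<epsilon>"] assms
      std_normal_distribution_even_moments[of 1] integral_std_normal_distribution_moment_odd[of 1]
    by (simp add: power_divide)
  finally show ?thesis .
qed

text \<open>Unless the noise reaches size \<open>\<delta>\<close>, it moves a point by less than
  \<open>\<delta>\<close>, so half-line events are nested after a shift by \<open>\<delta>\<close>.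
  Chebyshev bounds the exceptional event.\<close>

lemma cdf_gauss_smooth:
  assumes "\<epsilon> > 0" "\<delta> > 0"
  shows "cdf M x \<le> cdf (gauss_smooth \<epsilon> M) (x + \<delta>) + (\<epsilon> / \<delta>)\<^sup>2"
    and "cdf (gauss_smooth \<epsilon> M) x \<le> cdf M (x + \<delta>) + (\<epsilon> / \<delta>)\<^sup>2"
proof -
  let ?P = "M \<Otimes>\<^sub>M std_normal_distribution"
  have smooth: "cdf (gauss_smooth \<epsilon> M) y = measure ?P {p. fst p + \<epsilon> * snd p \<le> y}" for y
    unfolding cdf_def gauss_smooth_def
    by (subst measure_distr) (auto intro!: arg_cong[where f="measure _"] simp: space_pair_measure)
  have base: "cdf M y = measure ?P {p. fst p \<le> y}" for y
  proof -
    have "{p. fst p \<le> y} = {..y} \<times> space std_normal_distribution" by auto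
    then show ?thesis using SN.prob_space by (simp add: cdf_def measure_pair_normal_Times)
  qed
  have "{p \<in> space (borel \<Otimes>\<^sub>M borel). fst p + \<epsilon> * snd p \<le> y} \<in> sets (borel \<Otimes>\<^sub>M borel)"
    "{p \<in> space (borel \<Otimes>\<^sub>M borel). fst p \<le> y} \<in> sets (borel \<Otimes>\<^sub>M borel)"
    "{p \<in> space (borel \<Otimes>\<^sub>M borel). \<delta> \<le> \<bar>\<epsilon> * snd p\<bar>} \<in> sets (borel \<Otimes>\<^sub>M borel)" for y :: real
    by measurable
  then have sets [measurable]: "{p. fst p + \<epsilon> * snd p \<le> y} \<in> sets ?P"
    "{p. fst p \<le> y} \<in> sets ?P" "{p. \<delta> \<le> \<bar>\<epsilon> * snd p\<bar>} \<in> sets ?P" for y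
    by (simp_all add: space_pair_measure)
  have union: "measure ?P A \<le> measure ?P B + (\<epsilon> / \<delta>)\<^sup>2"
    if "A \<subseteq> B \<union> {p. \<delta> \<le> \<bar>\<epsilon> * snd p\<bar>}" and [measurable]: "A \<in> sets ?P" "B \<in> sets ?P" for A B
  proof -
    have "measure ?P A \<le> measure ?P (B \<union> {p. \<delta> \<le> \<bar>\<epsilon> * snd p\<bar>})"
      by (intro P.P.finite_measure_mono[OF that(1)] sets.Un) measurable
    also have "\<dots> \<le> measure ?P B + measure ?P {p. \<delta> \<le> \<bar>\<epsilon> * snd p\<bar>}"
      by (rule measure_Un_le) measurable
    finally show ?thesis using measure_snd_tail[OF assms] by linarith
  qed
  show "cdf M x \<le> cdf (gauss_smooth \<epsilon> M) (x + \<delta>) + (\<epsilon> / \<delta>)\<^sup>2"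
    unfolding smooth base by (rule union[OF _ sets(2,1)]) auto
  show "cdf (gauss_smooth \<epsilon> M) x \<le> cdf M (x + \<delta>) + (\<epsilon> / \<delta>)\<^sup>2"
    unfolding smooth base by (rule union[OF _ sets(1,2)]) auto
qed

end

section \<open>Normal approximation of sums\<close>

text \<open>The difference telescopes, one factor at a time. Keeping \<open>r ^ (n - 1)\<close>
  instead of bounding it by 1 is what later preserves Gaussian decay in \<open>t\<close>.\<close>

lemma norm_power_diff_le:
  fixes z w :: "'a :: {real_normed_algebra_1, comm_ring_1}"
  assumes "norm z \<le> r" "norm w \<le> r"
  shows "norm (z ^ n - w ^ n) \<le> n * r ^ (n - 1) * norm (z - w)"
proof (induction n)
  case (Suc n)
  have r: "0 \<le> r" using assms(1) norm_ge_zero order_trans by blast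
  have "z ^ Suc n - w ^ Suc n = z * (z ^ n - w ^ n) + w ^ n * (z - w)"
    by (simp add: algebra_simps)
  then have "norm (z ^ Suc n - w ^ Suc n) \<le> norm z * norm (z ^ n - w ^ n) + norm (w ^ n) * norm (z - w)"
    by (metis norm_mult_ineq norm_triangle_mono)
  also have "norm (w ^ n) \<le> r ^ n"
    using norm_power_ineq[of w n] power_mono[OF assms(2), of n] by simp
  also have "norm z * norm (z ^ n - w ^ n) \<le> r * (n * r ^ (n - 1) * norm (z - w))"
    using assms(1) Suc r by (intro mult_mono) auto
  also have "r * (n * r ^ (n - 1) * norm (z - w)) = n * r ^ n * norm (z - w)"
    by (cases n) (auto simp: algebra_simps)
  finally show ?case by (simp add: algebra_simps mult_right_mono)
qed simp

lemma exp_minus_ge_one_minus: "1 - u \<le> exp (- u)" for u :: real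
  using exp_ge_add_one_self[of "- u"] by simp

text \<open>The reciprocal of the quadratic lower bound for exp(u) is at most 1 - u + u^2/2, because
  the product of the two quadratics is 1 + u^4/4.\<close>

lemma exp_minus_le_quadratic:
  fixes u :: real
  assumes "0 \<le> u"
  shows "exp (- u) \<le> 1 - u + u\<^sup>2 / 2"
proof -
  have "1 + u + u\<^sup>2 / 2 \<le> exp u" using exp_lower_Taylor_quadratic assms by simp
  then have "exp (- u) \<le> 1 / (1 + u + u\<^sup>2 / 2)"
    using assms by (simp add: exp_minus divide_simps add_pos_nonneg)
  also have "\<dots> \<le> 1 - u + u\<^sup>2 / 2"
  proof -
    have "(1 - u + u\<^sup>2 / 2) * (1 + u + u\<^sup>2 / 2) = 1 + u ^ 4 / 4"
      by (simp add: algebra_simps power2_eq_square power4_eq_xxxx)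
    then show ?thesis using assms by (simp add: divide_simps add_pos_nonneg mult.commute)
  qed
  finally show ?thesis .
qed

text \<open>Both functions are compared with 1 - s^2/2: the Taylor remainder costs A|s|^3/6 and the
  Gaussian one s^4/8, at most A|s|^3/8. The radius 1/\<open>A\<close> makes A|s|^3 at most s^2, so
  the error cannot destroy the decay of the quadratic term.\<close>

lemma (in real_distribution) char_near_zero:
  assumes "integrable M (\<lambda>x. x)" "expectation (\<lambda>x. x) = 0"
    and "integrable M (\<lambda>x. x\<^sup>2)" "expectation (\<lambda>x. x\<^sup>2) = 1"
    and third: "integrable M (\<lambda>x. \<bar>x\<bar> ^ 3)" "expectation (\<lambda>x. \<bar>x\<bar> ^ 3) \<le> A"
    and A: "1 \<le> A" and s: "\<bar>s\<bar> \<le> 1 / A"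
  shows "cmod (char M s - complex_of_real (exp (- s\<^sup>2 / 2))) \<le> A * \<bar>s\<bar> ^ 3 / 3"
    and "cmod (char M s) \<le> exp (- s\<^sup>2 / 4)"
proof -
  have "cmod (char M s - (1 - s\<^sup>2 * 1 / 2)) \<le> (s\<^sup>2 / 6) * expectation (\<lambda>x. min (6 * x\<^sup>2) (\<bar>s\<bar> * \<bar>x\<bar> ^ 3))"
    by (rule char_approx3) (use assms in auto)
  also have "expectation (\<lambda>x. min (6 * x\<^sup>2) (\<bar>s\<bar> * \<bar>x\<bar> ^ 3)) \<le> expectation (\<lambda>x. \<bar>s\<bar> * \<bar>x\<bar> ^ 3)"
    using assms(3) third(1) by (intro integral_mono integrable_min integrable_mult_right) simp_all
  also have "expectation (\<lambda>x. \<bar>s\<bar> * \<bar>x\<bar> ^ 3) \<le> \<bar>s\<bar> * A"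
    using third by (simp add: mult_left_mono)
  also have "s\<^sup>2 / 6 * (\<bar>s\<bar> * A) = A * \<bar>s\<bar> ^ 3 / 6"
    by (simp add: power3_eq_cube power2_eq_square flip: abs_mult)
  finally have approx: "cmod (char M s - complex_of_real (1 - s\<^sup>2 / 2)) \<le> A * \<bar>s\<bar> ^ 3 / 6"
    by (simp add: mult_left_mono)
  have As: "A * \<bar>s\<bar> \<le> 1" using A s by (simp add: field_simps)
  have s1: "\<bar>s\<bar> \<le> 1" 
  proof -
    have "1 / A \<le> 1" using A by simp
    with s show ?thesis by linarith
  qed
  have cube: "A * \<bar>s\<bar> ^ 3 \<le> s\<^sup>2"
    using mult_right_mono[OF As, of "s\<^sup>2"]
    by (simp add: power3_eq_cube power2_eq_square flip: abs_mult)
  have fourth: "s ^ 4 \<le> A * \<bar>s\<bar> ^ 3"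
  proof -
    have "s ^ 4 = \<bar>s\<bar> * \<bar>s\<bar> ^ 3" by (simp flip: power_Suc)
    also have "\<dots> \<le> A * \<bar>s\<bar> ^ 3" using A s1 by (intro mult_right_mono) auto
    finally show ?thesis .
  qed
  have "\<bar>(1 - s\<^sup>2 / 2) - exp (- s\<^sup>2 / 2)\<bar> \<le> s ^ 4 / 8"
    using exp_minus_ge_one_minus[of "s\<^sup>2 / 2"] exp_minus_le_quadratic[of "s\<^sup>2 / 2"]
    by (simp add: power_divide flip: power_mult)
  then have "cmod (complex_of_real (1 - s\<^sup>2 / 2) - complex_of_real (exp (- s\<^sup>2 / 2))) \<le> A * \<bar>s\<bar> ^ 3 / 8"
    using fourth by (simp only: norm_of_real flip: of_real_diff)
  then have "cmod (char M s - complex_of_real (exp (- s\<^sup>2 / 2))) \<le> A * \<bar>s\<bar> ^ 3 / 6 + A * \<bar>s\<bar> ^ 3 / 8"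
    using norm_diff_triangle_le[OF approx] by blast
  also have "\<dots> \<le> A * \<bar>s\<bar> ^ 3 / 3" using A by (simp add: field_simps)
  finally show "cmod (char M s - complex_of_real (exp (- s\<^sup>2 / 2))) \<le> A * \<bar>s\<bar> ^ 3 / 3" by simp
  have "cmod (char M s) \<le> cmod (complex_of_real (1 - s\<^sup>2 / 2)) + cmod (char M s - complex_of_real (1 - s\<^sup>2 / 2))"
    by (metis add_diff_cancel_left' diff_add_cancel norm_triangle_ineq add.commute)
  also have "cmod (complex_of_real (1 - s\<^sup>2 / 2)) = 1 - s\<^sup>2 / 2"
    unfolding norm_of_real using s1 abs_square_le_1[of s] by simp
  also have "cmod (char M s - complex_of_real (1 - s\<^sup>2 / 2)) \<le> s\<^sup>2 / 6"
    using approx cube by linarith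
  \<comment> \<open>The left side is 1 - s^2/3; weakening it to 1/4 only simplifies later
    constants.\<close>
  also have "1 - s\<^sup>2 / 2 + s\<^sup>2 / 6 \<le> 1 - s\<^sup>2 / 4" by simp
  also have "\<dots> \<le> exp (- s\<^sup>2 / 4)" using exp_minus_ge_one_minus[of "s\<^sup>2 / 4"] by simp
  finally show "cmod (char M s) \<le> exp (- s\<^sup>2 / 4)" by simp
qed

text \<open>For |t| up to sqrt(n)/\<open>A\<close> the local estimate is raised to the power
  \<open>n\<close>; beyond that the trivial bound 2 is used. Adding the two bounds gives one formula
  valid for all \<open>t\<close>.\<close>

lemma char_power_normal_diff:
  fixes \<mu> :: "real measure"
  assumes "real_distribution \<mu>"
    and "integrable \<mu> (\<lambda>x. x)" "(\<integral>x. x \<partial>\<mu>) = 0"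
    and "integrable \<mu> (\<lambda>x. x\<^sup>2)" "(\<integral>x. x\<^sup>2 \<partial>\<mu>) = 1"
    and "integrable \<mu> (\<lambda>x. \<bar>x\<bar> ^ 3)" "(\<integral>x. \<bar>x\<bar> ^ 3 \<partial>\<mu>) \<le> A"
    and A: "1 \<le> A" and n: "2 \<le> n"
  shows "cmod (char \<mu> (t / sqrt n) ^ n - complex_of_real (exp (- t\<^sup>2 / 2)))
    \<le> A * \<bar>t\<bar> ^ 3 / (3 * sqrt n) * exp (- t\<^sup>2 / 8) + 2 * (A * \<bar>t\<bar> / sqrt n) ^ 3"
proof -
  interpret real_distribution \<mu> by fact
  define s where "s = t / sqrt n"
  have n0: "0 < n" using n by simp
  have cube: "sqrt n ^ 3 = n * sqrt n" by (simp add: power3_eq_cube)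
  have ts: "t = s * sqrt n" "t\<^sup>2 = s\<^sup>2 * n" using n0 by (simp_all add: s_def power_divide)
  have pow: "complex_of_real (exp (- t\<^sup>2 / 2)) = complex_of_real (exp (- s\<^sup>2 / 2)) ^ n"
    using n0 by (simp add: ts(2) flip: of_real_power exp_of_nat_mult)
  show ?thesis
  proof (cases "\<bar>s\<bar> \<le> 1 / A")
    case True
    note near = char_near_zero[OF assms(2-8) True]
    have "cmod (complex_of_real (exp (- s\<^sup>2 / 2))) \<le> exp (- s\<^sup>2 / 4)"
      unfolding norm_of_real by simp
    then have "cmod (char \<mu> s ^ n - complex_of_real (exp (- s\<^sup>2 / 2)) ^ n)
        \<le> n * exp (- s\<^sup>2 / 4) ^ (n - 1) * cmod (char \<mu> s - complex_of_real (exp (- s\<^sup>2 / 2)))"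
      using near(2) norm_power_diff_le by blast
    also have "\<dots> \<le> n * exp (- t\<^sup>2 / 8) * (A * \<bar>s\<bar> ^ 3 / 3)"
    proof (intro mult_mono near(1) mult_left_mono)
      have "exp (- s\<^sup>2 / 4) ^ (n - 1) = exp (- (s\<^sup>2 * (n - 1) / 4))"
        by (simp flip: exp_of_nat_mult add: mult.commute)
      also have "\<dots> \<le> exp (- t\<^sup>2 / 8)"
      proof -
        \<comment> \<open>From \<open>n\<close> at least 2, \<open>n - 1\<close> is at least half of
          \<open>n\<close>; this turns the exponent 1/4 into 1/8.\<close>
        have "s\<^sup>2 * n \<le> s\<^sup>2 * (2 * (real n - 1))"
          using n by (intro mult_left_mono) auto
        then show ?thesis using n0 by (simp add: ts(2) of_nat_diff algebra_simps)
      qed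
      finally show "exp (- s\<^sup>2 / 4) ^ (n - 1) \<le> exp (- t\<^sup>2 / 8)" .
    qed auto
    also have "\<dots> = A * \<bar>t\<bar> ^ 3 / (3 * sqrt n) * exp (- t\<^sup>2 / 8)"
      using n0 by (simp add: s_def power_divide cube ac_simps)
    finally have "cmod (char \<mu> s ^ n - complex_of_real (exp (- t\<^sup>2 / 2))) \<le> A * \<bar>t\<bar> ^ 3 / (3 * sqrt n) * exp (- t\<^sup>2 / 8)"
      unfolding pow .
    moreover have "0 \<le> 2 * (A * \<bar>t\<bar> / sqrt n) ^ 3" using A by simp
    ultimately show ?thesis unfolding s_def by linarith
  next
    case False
    then have "1 \<le> A * \<bar>s\<bar>" using A by (simp add: field_simps)
    \<comment> \<open>The cube is chosen so that, after division by |t| in the inversion bound, both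
      terms become second moments of Gaussians.\<close>
    then have "1 \<le> (A * \<bar>s\<bar>) ^ 3" by simp
    moreover have "cmod (char \<mu> s ^ n) \<le> 1"
      using cmod_char_le_1[of s] by (simp add: norm_power power_le_one)
    moreover have "cmod (complex_of_real (exp (- t\<^sup>2 / 2))) \<le> 1"
      unfolding norm_of_real by simp
    ultimately have "cmod (char \<mu> s ^ n - complex_of_real (exp (- t\<^sup>2 / 2))) \<le> 2 * (A * \<bar>s\<bar>) ^ 3"
      using norm_triangle_ineq4[of "char \<mu> s ^ n" "complex_of_real (exp (- t\<^sup>2 / 2))"] by linarith
    then show ?thesis using A by (simp add: s_def abs_divide add_increasing)
  qed
qed

lemma has_bochner_integral_square_gauss:
  assumes "0 < \<sigma>"
  shows "has_bochner_integral lborel (\<lambda>t. t\<^sup>2 * exp (- t\<^sup>2 / (2 * \<sigma>\<^sup>2))) (\<sigma> ^ 3 * sqrt (2 * pi))"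
proof -
  have "has_bochner_integral lborel (\<lambda>t. sqrt (2 * pi * \<sigma>\<^sup>2) * (normal_density 0 \<sigma> t * (t - 0) ^ (2 * 1)))
     (sqrt (2 * pi * \<sigma>\<^sup>2) * (fact (2 * 1) / ((2 / \<sigma>\<^sup>2) ^ 1 * fact 1)))"
    using normal_moment_even[OF assms, of 0 1] by (intro has_bochner_integral_mult_right) auto
  also have "(\<lambda>t. sqrt (2 * pi * \<sigma>\<^sup>2) * (normal_density 0 \<sigma> t * (t - 0) ^ (2 * 1))) = (\<lambda>t. t\<^sup>2 * exp (- t\<^sup>2 / (2 * \<sigma>\<^sup>2)))"
    using assms by (auto simp: normal_density_def)
  also have "sqrt (2 * pi * \<sigma>\<^sup>2) * (fact (2 * 1) / ((2 / \<sigma>\<^sup>2) ^ 1 * fact 1)) = \<sigma> ^ 3 * sqrt (2 * pi)"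
    using assms by (simp add: real_sqrt_mult power3_eq_cube power2_eq_square)
  finally show ?thesis .
qed

lemma cdf_std_normal_diff_le:
  assumes "x \<le> y"
  shows "cdf std_normal_distribution y - cdf std_normal_distribution x \<le> (y - x) / sqrt (2 * pi)"
proof (cases "x = y")
  case False
  interpret real_distribution std_normal_distribution by (rule real_dist_normal_dist)
  have le: "std_normal_density z \<le> 1 / sqrt (2 * pi)" for z
    by (simp add: std_normal_density_def divide_right_mono)
  have "emeasure std_normal_distribution {x<..y}
      = (\<integral>\<^sup>+z. ennreal (std_normal_density z) * indicator {x<..y} z \<partial>lborel)"
    by (rule emeasure_density) auto
  also have "\<dots> \<le> (\<integral>\<^sup>+z. ennreal (1 / sqrt (2 * pi)) * indicator {x<..y} z \<partial>lborel)"
    using le by (intro nn_integral_mono mult_right_mono ennreal_leI) auto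
  also have "\<dots> = ennreal ((y - x) / sqrt (2 * pi))"
    using assms by (subst nn_integral_cmult_indicator) (auto simp flip: ennreal_mult)
  finally have "measure std_normal_distribution {x<..y} \<le> (y - x) / sqrt (2 * pi)"
    using assms by (simp add: emeasure_eq_measure)
  with False assms show ?thesis by (simp add: cdf_diff_eq)
qed simp

text \<open>Gaussian smoothing costs \<open>\<delta> + (\<epsilon> / \<delta>)\<^sup>2\<close>, so the resulting rate is slightly worse
  than the \<open>n powr (-1/2)\<close> of Berry--Esseen, but better than \<open>n powr (-1/4)\<close>.\<close>

lemma cdf_normal_diff_le:
  fixes \<mu> \<nu> :: "real measure"
  assumes \<mu>: "real_distribution \<mu>"
    and moments: "integrable \<mu> (\<lambda>x. x)" "(\<integral>x. x \<partial>\<mu>) = 0"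
    "integrable \<mu> (\<lambda>x. x\<^sup>2)" "(\<integral>x. x\<^sup>2 \<partial>\<mu>) = 1"
    "integrable \<mu> (\<lambda>x. \<bar>x\<bar> ^ 3)" "(\<integral>x. \<bar>x\<bar> ^ 3 \<partial>\<mu>) \<le> A"
    and A: "1 \<le> A" and n: "2 \<le> n" and \<epsilon>: "0 < \<epsilon>" and \<delta>: "0 < \<delta>"
    and \<nu>: "real_distribution \<nu>" "\<And>t. char \<nu> t = char \<mu> (t / sqrt n) ^ n"
  shows "\<bar>cdf \<nu> x - cdf std_normal_distribution x\<bar>
    \<le> (8 * A / (3 * sqrt n) + 2 * (A / (sqrt n * \<epsilon>)) ^ 3) * sqrt (2 * pi) / pi
      + 2 * \<delta> / sqrt (2 * pi) + 2 * (\<epsilon> / \<delta>)\<^sup>2"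
proof -
  let ?N = std_normal_distribution
  interpret \<nu>: real_distribution \<nu> by fact
  interpret N: real_distribution ?N by (rule real_dist_normal_dist)
  have n0: "0 < n" using n by simp
  \<comment> \<open>The scales fit \<open>has_bochner_integral_square_gauss\<close>: 2 comes from
    exp(-t^2/8), and 1/\<open>\<epsilon>\<close> from the damping factor of the noise.\<close>
  define g where "g t = A / (3 * sqrt n) * (t\<^sup>2 * exp (- t\<^sup>2 / (2 * 2\<^sup>2)))
      + 2 * (A / sqrt n) ^ 3 * (t\<^sup>2 * exp (- t\<^sup>2 / (2 * (1 / \<epsilon>)\<^sup>2)))" for t :: real
  have g: "has_bochner_integral lborel g (A / (3 * sqrt n) * (2 ^ 3 * sqrt (2 * pi))
      + 2 * (A / sqrt n) ^ 3 * ((1 / \<epsilon>) ^ 3 * sqrt (2 * pi)))"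
    unfolding g_def using \<epsilon>
    by (intro has_bochner_integral_add has_bochner_integral_mult_right has_bochner_integral_square_gauss) auto
  have char_le: "cmod (char (gauss_smooth \<epsilon> \<nu>) t - char (gauss_smooth \<epsilon> ?N) t) \<le> \<bar>t\<bar> * g t" for t
  proof -
    let ?e = "exp (- (\<epsilon> * t)\<^sup>2 / 2)"
    have "char (gauss_smooth \<epsilon> \<nu>) t - char (gauss_smooth \<epsilon> ?N) t
        = (char \<mu> (t / sqrt n) ^ n - complex_of_real (exp (- t\<^sup>2 / 2))) * ?e"
      by (simp add: \<nu>.char_gauss_smooth N.char_gauss_smooth \<nu>(2) char_std_normal_distribution algebra_simps)
    then have "cmod (char (gauss_smooth \<epsilon> \<nu>) t - char (gauss_smooth \<epsilon> ?N) t)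
        = cmod (char \<mu> (t / sqrt n) ^ n - complex_of_real (exp (- t\<^sup>2 / 2))) * ?e"
      by (simp only: norm_mult norm_of_real abs_exp_cancel)
    also have "\<dots> \<le> (A * \<bar>t\<bar> ^ 3 / (3 * sqrt n) * exp (- t\<^sup>2 / 8) + 2 * (A * \<bar>t\<bar> / sqrt n) ^ 3) * ?e"
      by (intro mult_right_mono char_power_normal_diff[OF \<mu> moments A n]) auto
    \<comment> \<open>The first term decays by itself, so its damping factor is bounded by 1; for
      the second term the damping is the only source of integrability.\<close>
    also have "\<dots> \<le> A * \<bar>t\<bar> ^ 3 / (3 * sqrt n) * exp (- t\<^sup>2 / 8) * 1 + 2 * (A * \<bar>t\<bar> / sqrt n) ^ 3 * ?e"
      unfolding distrib_right using A by (intro add_mono mult_left_mono) auto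
    also have "\<dots> = \<bar>t\<bar> * g t"
      using \<epsilon> by (simp add: g_def power_divide power_mult_distrib power3_eq_cube power2_eq_square algebra_simps)
    finally show ?thesis .
  qed
  have smooth: "\<bar>cdf (gauss_smooth \<epsilon> \<nu>) y - cdf (gauss_smooth \<epsilon> ?N) y\<bar>
      \<le> (8 * A / (3 * sqrt n) + 2 * (A / (sqrt n * \<epsilon>)) ^ 3) * sqrt (2 * pi) / pi" for y
  proof -
    have "\<bar>cdf (gauss_smooth \<epsilon> \<nu>) y - cdf (gauss_smooth \<epsilon> ?N) y\<bar> \<le> integral\<^sup>L lborel g / pi"
      using g A \<epsilon> by (intro cdf_diff_le_char_integral char_le \<nu>.real_distribution_gauss_smooth
        N.real_distribution_gauss_smooth \<nu>.measure_gauss_smooth_singleton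
        N.measure_gauss_smooth_singleton) (auto simp: integrable.simps g_def)
    also have "integral\<^sup>L lborel g = (8 * A / (3 * sqrt n) + 2 * (A / (sqrt n * \<epsilon>)) ^ 3) * sqrt (2 * pi)"
      using has_bochner_integral_integral_eq[OF g]
      by (simp add: power_divide power_mult_distrib algebra_simps)
    finally show ?thesis .
  qed
  \<comment> \<open>Each direction smooths one law and unsmooths the other, which costs two shifts
    and two tail probabilities.\<close>
  have "cdf \<nu> x \<le> cdf (gauss_smooth \<epsilon> \<nu>) (x + \<delta>) + (\<epsilon> / \<delta>)\<^sup>2"
    "cdf (gauss_smooth \<epsilon> ?N) (x + \<delta>) \<le> cdf ?N (x + \<delta> + \<delta>) + (\<epsilon> / \<delta>)\<^sup>2"
    "cdf ?N (x - \<delta> - \<delta>) \<le> cdf (gauss_smooth \<epsilon> ?N) (x - \<delta> - \<delta> + \<delta>) + (\<epsilon> / \<delta>)\<^sup>2"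
    "cdf (gauss_smooth \<epsilon> \<nu>) (x - \<delta>) \<le> cdf \<nu> (x - \<delta> + \<delta>) + (\<epsilon> / \<delta>)\<^sup>2"
    using \<epsilon> \<delta> by (intro \<nu>.cdf_gauss_smooth N.cdf_gauss_smooth; simp)+
  moreover have "cdf ?N (x + \<delta> + \<delta>) - cdf ?N x \<le> 2 * \<delta> / sqrt (2 * pi)"
    using cdf_std_normal_diff_le[of x "x + \<delta> + \<delta>"] \<delta> by simp
  moreover have "cdf ?N x - cdf ?N (x - \<delta> - \<delta>) \<le> 2 * \<delta> / sqrt (2 * pi)"
    using cdf_std_normal_diff_le[of "x - \<delta> - \<delta>" x] \<delta> by simp
  ultimately show ?thesis
    using smooth[of "x + \<delta>"] smooth[of "x - \<delta>"] by (simp add: abs_le_iff)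
qed

section \<open>The quartic perturbation of the normal law\<close>

text \<open>A one-sided comparison of densities suffices: both masses are one, so applying it to the
  complement gives the reverse inequality.\<close>

lemma measure_density_diff_le:
  fixes p d h :: "'a \<Rightarrow> ennreal"
  assumes "prob_space (density M p)" "prob_space (density M d)"
    and [measurable]: "p \<in> borel_measurable M" "d \<in> borel_measurable M" "h \<in> borel_measurable M"
    and le: "\<And>x. x \<in> space M \<Longrightarrow> d x \<le> p x + h x"
    and h: "(\<integral>\<^sup>+x. h x \<partial>M) \<le> ennreal \<eta>" and \<eta>: "0 \<le> \<eta>"
    and A: "A \<in> sets M"
  shows "\<bar>measure (density M p) A - measure (density M d) A\<bar> \<le> \<eta>"
proof -
  interpret p: prob_space "density M p" by fact
  interpret d: prob_space "density M d" by fact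
  have lower: "measure (density M d) B \<le> measure (density M p) B + \<eta>" if [measurable]: "B \<in> sets M" for B
  proof -
    have "emeasure (density M d) B = (\<integral>\<^sup>+x. d x * indicator B x \<partial>M)"
      by (rule emeasure_density) auto
    also have "\<dots> \<le> (\<integral>\<^sup>+x. p x * indicator B x + h x \<partial>M)"
      using le by (intro nn_integral_mono) (auto split: split_indicator)
    also have "\<dots> = emeasure (density M p) B + (\<integral>\<^sup>+x. h x \<partial>M)"
      by (simp add: nn_integral_add emeasure_density)
    also have "\<dots> \<le> emeasure (density M p) B + ennreal \<eta>"
      using h by (rule add_left_mono)
    finally show ?thesis
      using \<eta> by (simp add: p.emeasure_eq_measure d.emeasure_eq_measure flip: ennreal_plus)
  qed
  have "measure (density M p) (space M - A) = 1 - measure (density M p) A"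
    using p.prob_compl[of A] A by simp
  moreover have "measure (density M d) (space M - A) = 1 - measure (density M d) A"
    using d.prob_compl[of A] A by simp
  ultimately show ?thesis
    using lower[OF A] lower[of "space M - A"] A by auto
qed

lemma cdf_normal_scale:
  assumes "0 < \<sigma>"
  shows "cdf (density lborel (normal_density 0 \<sigma>)) x = cdf std_normal_distribution (x / \<sigma>)"
proof -
  interpret N: real_distribution std_normal_distribution by (rule real_dist_normal_dist)
  have "distributed std_normal_distribution lborel (\<lambda>z. z) std_normal_density"
    by (auto simp: distributed_def distr_id2)
  then have "distributed std_normal_distribution lborel (\<lambda>z. 0 + \<sigma> * z) (normal_density (0 + \<sigma> * 0) (\<bar>\<sigma>\<bar> * 1))"
    using assms by (intro N.normal_density_affine) auto
  then have "density lborel (normal_density 0 \<sigma>) = distr std_normal_distribution lborel (\<lambda>z. \<sigma> * z)"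
    using assms by (simp add: distributed_def)
  then have "cdf (density lborel (normal_density 0 \<sigma>)) x
      = measure std_normal_distribution ((\<lambda>z. \<sigma> * z) -` {..x} \<inter> space std_normal_distribution)"
    unfolding cdf_def by (simp only:) (rule measure_distr, auto)
  also have "(\<lambda>z. \<sigma> * z) -` {..x} \<inter> space std_normal_distribution = {..x / \<sigma>}"
    using assms by (auto simp: field_simps)
  finally show ?thesis by (simp add: cdf_def)
qed

text \<open>Since exp(-u) is at least 1 - u, the quartic factor removes at most C y^4 / (4
  \<gamma>^8) times the normal density, and renormalising only enlarges the density. The normal
  fourth moment 3 \<gamma>^4 gives the bound.\<close>

lemma cdf_H_law_diff_le:
  assumes prob: "prob_space (H_law (Phi C) \<gamma>)" and C: "0 \<le> C" and \<gamma>: "0 < \<gamma>"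
  shows "\<bar>cdf (H_law (Phi C) \<gamma>) x - cdf std_normal_distribution (x / \<gamma>)\<bar> \<le> 3 * C / (4 * \<gamma> ^ 4)"
proof -
  define k where "k = sqrt (2 * pi * \<gamma>\<^sup>2)"
  have k: "0 < k" using \<gamma> by (simp add: k_def)
  define D where "D = normal_density 0 \<gamma>"
  have D_nonneg: "0 \<le> D y" for y by (simp add: D_def)
  have D_meas [measurable]: "D \<in> borel_measurable borel" by (simp add: D_def)
  have D_int: "integrable lborel D" using \<gamma> by (simp add: D_def)
  have Phi_meas [measurable]: "Phi C \<in> borel_measurable borel"
    unfolding Phi_def[abs_def] by measurable
  have Phi_le: "Phi C y \<le> 1" and Phi_nonneg: "0 \<le> Phi C y" and Phi_ge: "1 - C * y ^ 4 / 4 \<le> Phi C y" for y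
    using C exp_minus_ge_one_minus[of "C * y ^ 4 / 4"] by (simp_all add: Phi_def)
  have weight: "H_weight (Phi C) \<gamma> = (\<lambda>y. k * (Phi C (y / \<gamma>\<^sup>2) * D y))"
    using \<gamma> by (auto simp: H_weight_def D_def k_def normal_density_def)
  define W where "W = (\<integral>y. H_weight (Phi C) \<gamma> y \<partial>lborel)"
  have PhiD_int: "integrable lborel (\<lambda>y. Phi C (y / \<gamma>\<^sup>2) * D y)"
    by (rule Bochner_Integration.integrable_bound[OF D_int])
      (auto simp: abs_mult Phi_nonneg D_nonneg intro!: mult_left_le_one_le Phi_le)
  have "W \<le> k * (\<integral>y. D y \<partial>lborel)"
    unfolding W_def weight using k PhiD_int D_int
    by (auto intro!: integral_mono mult_left_le_one_le simp: Phi_le Phi_nonneg D_nonneg)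
  then have Wk: "W \<le> k" using \<gamma> by (simp add: D_def)
  have W0: "0 \<le> W"
    unfolding W_def weight using k by (auto intro!: integral_nonneg_AE simp: Phi_nonneg D_nonneg)
  \<comment> \<open>If \<open>W\<close> were 0, division by zero would make the density vanish,
    contradicting total mass one.\<close>
  have "W \<noteq> 0"
  proof
    assume "W = 0"
    then have "emeasure (H_law (Phi C) \<gamma>) (space (H_law (Phi C) \<gamma>)) = 0"
      by (simp add: H_law_def W_def emeasure_density)
    then show False using prob_space.emeasure_space_1[OF prob] by simp
  qed
  with W0 have W: "0 < W" by simp
  define h where "h y = C / (4 * \<gamma> ^ 8) * (D y * (y - 0) ^ (2 * 2))" for y
  have h: "has_bochner_integral lborel h (3 * C / (4 * \<gamma> ^ 4))"
  proof -
    have "has_bochner_integral lborel h (C / (4 * \<gamma> ^ 8) * (fact (2 * 2) / ((2 / \<gamma>\<^sup>2) ^ 2 * fact 2)))"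
      unfolding h_def D_def using \<gamma> by (intro has_bochner_integral_mult_right normal_moment_even)
    also have "C / (4 * \<gamma> ^ 8) * (fact (2 * 2) / ((2 / \<gamma>\<^sup>2) ^ 2 * fact 2)) = 3 * C / (4 * \<gamma> ^ 4)"
      using \<gamma> by (simp add: fact_numeral field_simps flip: power_add power_mult)
    finally show ?thesis .
  qed
  have h_nonneg: "0 \<le> h y" for y using C \<gamma> D_nonneg by (simp add: h_def)
  have [measurable]: "h \<in> borel_measurable borel" unfolding h_def[abs_def] by measurable
  have "\<bar>measure (H_law (Phi C) \<gamma>) {..x} - measure (density lborel (\<lambda>y. ennreal (D y))) {..x}\<bar> \<le> 3 * C / (4 * \<gamma> ^ 4)"
    unfolding H_law_def W_def[symmetric]
  proof (rule measure_density_diff_le[where h = "\<lambda>y. ennreal (h y)"])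
    show "prob_space (density lborel (\<lambda>y. ennreal (H_weight (Phi C) \<gamma> y / W)))"
      using prob by (simp add: H_law_def W_def)
    show "prob_space (density lborel (\<lambda>y. ennreal (D y)))"
      unfolding D_def using \<gamma> by (rule prob_space_normal_density)
    show "(\<lambda>y. ennreal (H_weight (Phi C) \<gamma> y / W)) \<in> borel_measurable lborel"
      unfolding weight by measurable
    show "(\<integral>\<^sup>+y. ennreal (h y) \<partial>lborel) \<le> ennreal (3 * C / (4 * \<gamma> ^ 4))"
      using h h_nonneg by (subst nn_integral_eq_integral) (auto simp: has_bochner_integral_iff)
    fix y :: real
    have "D y - h y = (1 - C * (y / \<gamma>\<^sup>2) ^ 4 / 4) * D y"
      using \<gamma> by (simp add: h_def power_divide algebra_simps flip: power_mult)
    also have "\<dots> \<le> Phi C (y / \<gamma>\<^sup>2) * D y" by (intro mult_right_mono Phi_ge D_nonneg)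
    \<comment> \<open>The weight is \<open>k\<close> times the previous expression, and
      \<open>k / W\<close> is at least 1.\<close>
    also have "\<dots> \<le> H_weight (Phi C) \<gamma> y / W"
      using mult_right_mono[OF Wk, of "Phi C (y / \<gamma>\<^sup>2) * D y"] W
      by (simp add: weight Phi_nonneg D_nonneg field_simps)
    finally have "D y \<le> H_weight (Phi C) \<gamma> y / W + h y" by simp
    moreover have "0 \<le> H_weight (Phi C) \<gamma> y / W"
      using W k by (simp add: weight Phi_nonneg D_nonneg)
    ultimately show "ennreal (D y) \<le> ennreal (H_weight (Phi C) \<gamma> y / W) + ennreal (h y)"
      using h_nonneg[of y] by (metis ennreal_leI ennreal_plus)
  qed (use C \<gamma> in auto)
  then show ?thesis using cdf_normal_scale[OF \<gamma>, of x] by (simp add: cdf_def D_def)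
qed

section \<open>Scaled i.i.d. sums and assembly of the rates\<close>

lemma (in prob_space) char_distr_sum_divide:
  fixes Xs :: "'i \<Rightarrow> 'a \<Rightarrow> real"
  assumes indep: "indep_vars (\<lambda>_. borel) Xs I"
    and law: "\<And>i. i \<in> I \<Longrightarrow> distr M borel (Xs i) = \<mu>"
  shows "char (distr M borel (\<lambda>\<omega>. (\<Sum>i\<in>I. Xs i \<omega>) / s)) t = char \<mu> (t / s) ^ card I"
proof -
  have rv: "random_variable borel (Xs i)" if "i \<in> I" for i
    using indep that by (auto simp: indep_vars_def)
  have "indep_vars (\<lambda>_. borel) (\<lambda>i \<omega>. Xs i \<omega> / s) I"
    by (rule indep_vars_compose2[OF indep, where Y="\<lambda>_ x. x / s"]) auto
  then have "char (distr M borel (\<lambda>\<omega>. \<Sum>i\<in>I. Xs i \<omega> / s)) t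
      = (\<Prod>i\<in>I. char (distr M borel (\<lambda>\<omega>. Xs i \<omega> / s)) t)"
    by (rule char_distr_sum)
  also have "\<dots> = (\<Prod>i\<in>I. char \<mu> (t / s))"
  proof (rule prod.cong)
    fix i assume i: "i \<in> I"
    note [measurable] = rv[OF i]
    show "char (distr M borel (\<lambda>\<omega>. Xs i \<omega> / s)) t = char \<mu> (t / s)"
      unfolding char_def law[OF i, symmetric] by (simp add: integral_distr)
  qed simp
  finally show ?thesis by (simp add: sum_divide_distrib)
qed

text \<open>With \<epsilon> = n^(-a) and \<delta> = n^(-b), the critical orders are n^(-3(1/2-a)),
  n^(-b) and n^(-2(a-b)). All beat n^(-1/4) when b > 1/4 and b + 1/8 < a < 5/12; a = 2/5 and b =
  13/50 give the exponents -3/10, -13/50 and -7/25.\<close>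

lemma error_bound_smallo:
  fixes a b c d e :: real
  shows "(\<lambda>n::nat. a * (1 / sqrt n) + b * (1 / (sqrt n * n powr (-2/5))) ^ 3 + c * n powr (-13/50)
      + d * (n powr (-2/5) / n powr (-13/50))\<^sup>2 + e * (1 / n)) \<in> o(\<lambda>n. 1 / n powr (1/4))"
proof -
  have cmult: "(\<lambda>n. u * f n) \<in> o(g)" if "f \<in> o(g)" for u :: real and f g :: "nat \<Rightarrow> real"
    using that by (cases "u = 0") auto
  show ?thesis
    by (intro sum_in_smallo cmult; real_asymp)
qed

lemma abs_power_le_one_plus_fourth:
  fixes x :: real
  assumes "k \<le> 4"
  shows "\<bar>x\<bar> ^ k \<le> 1 + x ^ 4"
proof (cases "\<bar>x\<bar> \<le> 1")
  case True
  then have "\<bar>x\<bar> ^ k \<le> 1" by (simp add: power_le_one)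
  then show ?thesis by (simp add: add_increasing2)
next
  case False
  then have "\<bar>x\<bar> ^ k \<le> \<bar>x\<bar> ^ 4" using assms by (intro power_increasing) auto
  then show ?thesis by simp
qed

theorem corollary4p3:
  fixes N :: "'b measure" and X :: "'b \<Rightarrow> real"
    and M :: "'a measure" and Xs :: "nat \<Rightarrow> 'a \<Rightarrow> real" and Z :: "nat \<Rightarrow> 'a \<Rightarrow> real"
    and Q :: "nat \<Rightarrow> 'c measure" and H :: "nat \<Rightarrow> 'c \<Rightarrow> real"
    and R :: "'d measure" and G :: "'d \<Rightarrow> real"
    and \<gamma> :: "nat \<Rightarrow> real" and C c1 :: real
  assumes "prob_space N" and "X \<in> borel_measurable N" and "symmetric_rv N X"
    and "integrable N (\<lambda>\<omega>. X \<omega> ^ 4)"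
    and "(\<integral>\<omega>. X \<omega> \<partial>N) = 0"
    and "(\<integral>\<omega>. (X \<omega>)\<^sup>2 \<partial>N) = 1"
    and "(\<integral>\<omega>. X \<omega> ^ 4 \<partial>N) < 3"
    and "prob_space M"
    and "prob_space.indep_vars M (\<lambda>_. borel) Xs {1..}"
    and "\<And>k. k \<ge> 1 \<Longrightarrow> distr M borel (Xs k) = distr N borel X"
    and "\<And>n. \<gamma> n = real n powr (1/4)"
    and "\<And>n \<omega>. Z n \<omega> = 1 / real n powr (1/4) * (\<Sum>k=1..n. Xs k \<omega>)"
    and "C = (3 - (\<integral>\<omega>. X \<omega> ^ 4 \<partial>N)) / 6"
    and "prob_space R" and "distributed R lborel G (\<lambda>x. ennreal (std_normal_density x))"
    and "c1 = sqrt (2 * pi) * (\<integral>\<omega>. exp (- C * G \<omega> ^ 4 / 4) \<partial>R)"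
    and "\<And>n. n \<ge> 1 \<Longrightarrow> prob_space (Q n)"
    and "\<And>n. n \<ge> 1 \<Longrightarrow> H n \<in> borel_measurable (Q n)"
    and "\<And>n. n \<ge> 1 \<Longrightarrow> distr (Q n) borel (H n) = H_law (Phi C) (\<gamma> n)"
  shows "\<exists>r :: nat \<Rightarrow> real. r \<in> O(\<lambda>n. 1 / (\<gamma> n)\<^sup>2) \<and>
           (\<forall>n\<ge>1. d_Kol M (Z n) (Q n) (H n)
                    \<le> 4 * (1 - C) powr (1/4) * c1 powr (-1/2) / \<gamma> n + r n)"
proof -
  interpret N: prob_space N by fact
  interpret M: prob_space M by fact
  interpret R: prob_space R by fact
  note [measurable] = \<open>X \<in> borel_measurable N\<close>
  define m4 where "m4 = (\<integral>\<omega>. X \<omega> ^ 4 \<partial>N)"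
  have m4_nonneg: "0 \<le> m4" unfolding m4_def by (simp add: integral_nonneg_AE)
  have "C = (3 - m4) / 6" "m4 < 3" using assms(7,13) by (simp_all add: m4_def)
  \<comment> \<open>As \<open>m4\<close> lies in [0, 3), C is at most 1/2, so the base 1 - C of the
    leading constant is positive.\<close>
  with m4_nonneg have C: "0 \<le> C" "0 < 1 - C" by simp_all
  define \<mu> where "\<mu> = distr N borel X"
  interpret \<mu>: real_distribution \<mu> unfolding \<mu>_def by (rule N.real_distribution_distr) measurable
  have X_int: "integrable N (\<lambda>\<omega>. X \<omega> ^ k)" if "k \<le> 4" for k
    by (rule Bochner_Integration.integrable_bound[of N "\<lambda>\<omega>. 1 + X \<omega> ^ 4"])
      (use assms(4) abs_power_le_one_plus_fourth[OF that] in \<open>auto simp: power_abs add_increasing\<close>)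
  have X3: "integrable N (\<lambda>\<omega>. \<bar>X \<omega>\<bar> ^ 3)"
    using integrable_abs[OF X_int[of 3]] by (simp add: power_abs)
  \<comment> \<open>The third moment is dominated through the fourth; taking \<open>A\<close> as
    \<open>1 + m4\<close> also makes \<open>A\<close> at least 1.\<close>
  have moments: "integrable \<mu> (\<lambda>x. x)" "(\<integral>x. x \<partial>\<mu>) = 0"
    "integrable \<mu> (\<lambda>x. x\<^sup>2)" "(\<integral>x. x\<^sup>2 \<partial>\<mu>) = 1"
    "integrable \<mu> (\<lambda>x. \<bar>x\<bar> ^ 3)" "(\<integral>x. \<bar>x\<bar> ^ 3 \<partial>\<mu>) \<le> 1 + m4"
  proof -
    have "(\<integral>\<omega>. \<bar>X \<omega>\<bar> ^ 3 \<partial>N) \<le> (\<integral>\<omega>. 1 + X \<omega> ^ 4 \<partial>N)"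
      using X3 assms(4) by (intro integral_mono abs_power_le_one_plus_fourth) auto
    also have "\<dots> = 1 + m4" using assms(4) by (simp add: m4_def N.prob_space)
    finally show "(\<integral>x. \<bar>x\<bar> ^ 3 \<partial>\<mu>) \<le> 1 + m4" by (simp add: \<mu>_def integral_distr)
  qed (use X_int[of 1] X_int[of 2] X3 assms(5,6) in
    \<open>simp_all add: \<mu>_def integrable_distr_eq integral_distr\<close>)

  define K where "K = 4 * (1 - C) powr (1/4) * c1 powr (-1/2)"
  \<comment> \<open>Strict positivity is what lets the leading term absorb every error of order
    o(n^(-1/4)).\<close>
  have K: "0 < K"
  proof -
    have [measurable]: "G \<in> borel_measurable R"
      using assms(15) by (auto simp: distributed_def)
    have "integrable R (\<lambda>\<omega>. exp (- C * G \<omega> ^ 4 / 4))"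
      using C by (intro R.integrable_const_bound[of _ 1]) auto
    then have "(\<integral>\<omega>. 0 \<partial>R) < (\<integral>\<omega>. exp (- C * G \<omega> ^ 4 / 4) \<partial>R)"
      using R.emeasure_space_1 by (intro R.integral_less_AE_space) auto
    then have "0 < c1" by (simp add: assms(16))
    with C show ?thesis by (simp add: K_def)
  qed

  \<comment> \<open>This is the sum of the bounds of \<open>cdf_normal_diff_le\<close> and
    \<open>cdf_H_law_diff_le\<close>, regrouped to match \<open>error_bound_smallo\<close>.\<close>
  define rate :: "nat \<Rightarrow> real" where "rate n =
      (8 * (1 + m4) / 3 * sqrt (2 * pi) / pi) * (1 / sqrt n)
    + (2 * (1 + m4) ^ 3 * sqrt (2 * pi) / pi) * (1 / (sqrt n * n powr (-2/5))) ^ 3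
    + (2 / sqrt (2 * pi)) * n powr (-13/50) + 2 * (n powr (-2/5) / n powr (-13/50))\<^sup>2
    + (3 * C / 4) * (1 / n)" for n
  have d_Kol_le: "d_Kol M (Z n) (Q n) (H n) \<le> rate n" if n: "2 \<le> n" for n
    unfolding d_Kol_def
  proof (rule cSUP_least)
    fix x :: real
    have n0: "0 < real n" and n1: "1 \<le> n" using n by simp_all
    have \<gamma>: "0 < \<gamma> n" "(\<gamma> n)\<^sup>2 = sqrt n" "\<gamma> n ^ 4 = n"
      using n0 by (simp_all add: assms(11) powr_power powr_half_sqrt)
    define \<nu> where "\<nu> = distr M borel (\<lambda>\<omega>. (\<Sum>k\<in>{1..n}. Xs k \<omega>) / sqrt n)"
    have rv [measurable]: "Xs k \<in> borel_measurable M" if "k \<in> {1..n}" for k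
      using assms(9) that by (auto simp: M.indep_vars_def)
    have sum_meas [measurable]: "(\<lambda>\<omega>. (\<Sum>k\<in>{1..n}. Xs k \<omega>) / sqrt n) \<in> borel_measurable M"
      by measurable
    have \<nu>: "real_distribution \<nu>"
      unfolding \<nu>_def by (rule M.real_distribution_distr) measurable
    have char_\<nu>: "char \<nu> t = char \<mu> (t / sqrt n) ^ n" for t
      unfolding \<nu>_def \<mu>_def
      using M.char_distr_sum_divide[OF M.indep_vars_subset[OF assms(9)], of "{1..n}"] assms(10) by auto
    \<comment> \<open>Dividing by \<open>\<gamma> n\<close> once more turns the normalisation
      n^(1/4) into sqrt(n), as \<open>\<gamma> n\<close> squared is sqrt(n).\<close>
    have "measure M {\<omega> \<in> space M. Z n \<omega> \<le> x} = cdf \<nu> (x / \<gamma> n)"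
    proof -
      have "Z n \<omega> = (\<Sum>k\<in>{1..n}. Xs k \<omega>) / \<gamma> n" for \<omega>
        by (simp add: assms(11,12))
      moreover have "(\<Sum>k\<in>{1..n}. Xs k \<omega>) / sqrt n = (\<Sum>k\<in>{1..n}. Xs k \<omega>) / \<gamma> n / \<gamma> n" for \<omega>
        unfolding \<gamma>(2)[symmetric] by (simp add: power2_eq_square)
      ultimately have "Z n \<omega> \<le> x \<longleftrightarrow> (\<Sum>k\<in>{1..n}. Xs k \<omega>) / sqrt n \<le> x / \<gamma> n" for \<omega>
        using \<gamma>(1) by (simp only: divide_right_mono divide_le_cancel) auto
      then show ?thesis
        unfolding cdf_def \<nu>_def by (subst measure_distr) (auto intro!: arg_cong[where f="measure M"])
    qed
    moreover have "measure (Q n) {\<omega> \<in> space (Q n). H n \<omega> \<le> x} = cdf (H_law (Phi C) (\<gamma> n)) x"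
      using assms(18)[OF n1] unfolding cdf_def assms(19)[OF n1, symmetric]
      by (subst measure_distr) (auto intro!: arg_cong[where f="measure (Q n)"])
    moreover have "\<bar>cdf \<nu> (x / \<gamma> n) - cdf std_normal_distribution (x / \<gamma> n)\<bar>
      \<le> (8 * (1 + m4) / (3 * sqrt n) + 2 * ((1 + m4) / (sqrt n * n powr (-2/5))) ^ 3) * sqrt (2 * pi) / pi
        + 2 * n powr (-13/50) / sqrt (2 * pi) + 2 * (n powr (-2/5) / n powr (-13/50))\<^sup>2"
      using m4_nonneg n0
      by (intro cdf_normal_diff_le[OF \<mu>.real_distribution_axioms moments _ n _ _ \<nu> char_\<nu>]) auto
    moreover have "\<bar>cdf (H_law (Phi C) (\<gamma> n)) x - cdf std_normal_distribution (x / \<gamma> n)\<bar> \<le> 3 * C / (4 * n)"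
    proof -
      have "prob_space (H_law (Phi C) (\<gamma> n))"
        using prob_space.prob_space_distr[OF assms(17,18)[OF n1]] assms(19)[OF n1] by simp
      from cdf_H_law_diff_le[OF this C(1) \<gamma>(1), of x] show ?thesis by (simp add: \<gamma>(3))
    qed
    moreover have "rate n = (8 * (1 + m4) / (3 * sqrt n) + 2 * ((1 + m4) / (sqrt n * n powr (-2/5))) ^ 3) * sqrt (2 * pi) / pi
        + 2 * n powr (-13/50) / sqrt (2 * pi) + 2 * (n powr (-2/5) / n powr (-13/50))\<^sup>2 + 3 * C / (4 * n)"
      unfolding rate_def power_divide by (simp add: add_divide_distrib algebra_simps)
    ultimately show "\<bar>measure M {\<omega> \<in> space M. Z n \<omega> \<le> x} - measure (Q n) {\<omega> \<in> space (Q n). H n \<omega> \<le> x}\<bar> \<le> rate n"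
      by linarith
  qed simp

  \<comment> \<open>With the positive excess as remainder the inequality holds for every
    \<open>n\<close> by construction; the content is that this excess eventually vanishes.\<close>
  define r where "r n = max 0 (d_Kol M (Z n) (Q n) (H n) - K / \<gamma> n)" for n
  have "rate \<in> o(\<lambda>n. 1 / n powr (1/4))"
    unfolding rate_def by (rule error_bound_smallo)
  \<comment> \<open>The little-o property is used with the leading constant \<open>K\<close> itself
    as the small factor.\<close>
  then have "\<forall>\<^sub>F n in sequentially. norm (rate n) \<le> K * norm (1 / n powr (1/4))"
    using K by (rule landau_o.smallD)
  then have "\<forall>\<^sub>F n in sequentially. r n = 0"
    using eventually_ge_at_top[of 2]
  proof eventually_elim
    case (elim n)
    then show ?case using d_Kol_le[of n] by (simp add: r_def assms(11))
  qed
  then have "r \<in> O(\<lambda>n. 1 / (\<gamma> n)\<^sup>2)"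
    by (intro bigoI[where c = 1]) (auto elim!: eventually_mono)
  moreover have "d_Kol M (Z n) (Q n) (H n) \<le> K / \<gamma> n + r n" for n
    by (simp add: r_def)
  ultimately show ?thesis unfolding K_def by blast
qed

end
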